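(* For arbitrarily small $\epsilon,\delta>0$ there exists an infinite class of protocol sequence sets, containing sets with arbitrarily large numbers of sequences, such that the members of the class with $M$ sequences have sequence length $L=O(M^{2+\epsilon})$, and for all sufficiently large $M$, the members of the class with $M$ sequences have system throughput at least $0.25-\delta$ for every choice of delay offsets when the $M$ sequences are used by $M$ users, one sequence per user.
   Context: A protocol sequence set of length $L$ with $M$ sequences is a collection of $M$ periodic binary sequences $a_1(t),\ldots,a_M(t)$ of common period $L$. Collision channel without feedback (all users permanently active): time is slotted; user $i$ has an arbitrary fixed delay offset $\tau_i$ and transmits a packet in slot $t$ iff $a_i(t+\tau_i)=1$. A packet is received successfully iff exactly one user transmits in its slot. The system throughput, for given delay offsets, is the number of slots in one period of $L$ slots in which exactly one user transmits, divided by $L$. The implied constant in $O(\cdot)$ is uniform over the class. *)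

theory Defs
  imports Complex_Main
begin

text \<open>
  Time slots and delay offsets are integers, and \<open>True\<close> encodes the symbol 1.  User \<open>i < M\<close> is
  assigned the \<open>i\<close>-th entry of a list of \<open>M\<close> sequences.  Since the sequences form a set of \<open>M\<close>
  sequences, they are pairwise distinct.  \<open>L\<close> need not be the least period.
\<close>

definition protocol_sequence_set :: "nat \<Rightarrow> (int \<Rightarrow> bool) list \<Rightarrow> bool" where
  "protocol_sequence_set L A \<longleftrightarrow>
     L > 0 \<and> distinct A \<and> (\<forall>a\<in>set A. \<forall>t. a (t + int L) = a t)"

definition transmits :: "(int \<Rightarrow> bool) list \<Rightarrow> (nat \<Rightarrow> int) \<Rightarrow> nat \<Rightarrow> int \<Rightarrow> bool" where
  "transmits A \<tau> i t \<longleftrightarrow> i < length A \<and> (A ! i) (t + \<tau> i)"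

definition throughput :: "nat \<Rightarrow> (int \<Rightarrow> bool) list \<Rightarrow> (nat \<Rightarrow> int) \<Rightarrow> real" where
  "throughput L A \<tau> = real (card {t \<in> {0..<int L}. \<exists>!i. transmits A \<tau> i t}) / real L"

end

theory Submission
  imports Defs "HOL-Number_Theory.Cong" "HOL-Computational_Algebra.Primes"
begin

text \<open>
  Fix a prime \<open>p = 2 M + 1\<close> and a constant \<open>m\<close>, and put \<open>q = p m\<close>.  Writing a time slot as
  \<open>t = q k + y\<close> with \<open>0 \<le> y < q\<close>, user \<open>g\<close> transmits iff \<open>k \<equiv> g y (mod p)\<close>.  Each sequence has
  period \<open>p q\<close> and weight \<open>q\<close>.  If two users collide in slot \<open>t\<close>, then \<open>y\<close> solves one of two linear
  congruences modulo \<open>p\<close> with leading coefficient the difference of the two users; which of the two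
  depends on whether adding the relative delay to \<open>y\<close> produces a carry, hence on the side of \<open>y\<close> with
  respect to a threshold.  So any two users collide at most \<open>m + 1\<close> times per period, and the union
  bound leaves at least \<open>M (q - (M - 1) (m + 1)) \<approx> p q / 4\<close> successful slots.
\<close>

section \<open>Sequences given by slopes modulo p: period, distinctness, weight\<close>

definition slope_seq :: "int \<Rightarrow> int \<Rightarrow> int \<Rightarrow> int \<Rightarrow> bool" where
  "slope_seq p q g t \<longleftrightarrow> [t div q = g * (t mod q)] (mod p)"

lemma slope_seq_periodic:
  assumes "q > 0"
  shows "slope_seq p q g (t + p * q) = slope_seq p q g t"
  using assms by (simp add: slope_seq_def cong_def)

text \<open>Since \<open>q > 1\<close>, the slot \<open>1 + g * q\<close> has remainder 1 and
  quotient \<open>g\<close>. There the sequence of slope \<open>h\<close> is 1 iff \<open>g\<close>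
  and \<open>h\<close> agree modulo \<open>p\<close>, so a single slot separates incongruent
  slopes.\<close>

lemma slope_seq_eq_imp_cong:
  assumes "q > 1" "slope_seq p q g = slope_seq p q h"
  shows "[g = h] (mod p)"
proof -
  have "slope_seq p q g (1 + g * q)"
    using assms(1) by (simp add: slope_seq_def cong_def)
  hence "slope_seq p q h (1 + g * q)"
    by (simp add: assms(2))
  thus ?thesis
    using assms(1) by (simp add: slope_seq_def)
qed

lemma zdiv_less:
  fixes t p q :: int
  assumes "q > 0" "t < p * q"
  shows "t div q < p"
proof (rule ccontr)
  assume "\<not> t div q < p"
  hence "p * q \<le> t div q * q"
    using assms(1) by (intro mult_right_mono) auto
  also have "\<dots> \<le> t"
    using assms(1) by (simp flip: minus_mod_eq_div_mult)
  finally show False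
    using assms(2) by simp
qed

text \<open>Shifting by \<open>s\<close> and reducing modulo \<open>L\<close> permutes one period.
  Counts over a period therefore depend only on relative delays.\<close>

lemma card_periodic_shift:
  fixes L s :: int
  assumes "L > 0" and per: "\<And>t. P (t + L) = P t"
  shows "card {t \<in> {0..<L}. P (t + s)} = card {t \<in> {0..<L}. P t}"
proof -
  have up: "P (t + int n * L) = P t" for t n
  proof (induction n)
    case (Suc n)
    have "t + int (Suc n) * L = (t + int n * L) + L"
      by (simp add: algebra_simps)
    thus ?case
      using per Suc by metis
  qed simp
  have mult: "P (t + k * L) = P t" for t k
  proof (cases "k \<ge> 0")
    case True
    thus ?thesis
      using up[of t "nat k"] by simp
  next
    case False
    thus ?thesis
      using up[of "t + k * L" "nat (- k)"] by simp
  qed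
  have mod: "P (t mod L) = P t" for t
    using mult[of "t mod L" "t div L"] by simp
  have unshift: "P ((t - s) mod L + s) = P t" for t
  proof -
    have "P ((t - s) mod L + s) = P (((t - s) mod L + s) mod L)"
      by (simp only: mod)
    also have "((t - s) mod L + s) mod L = t mod L"
      by (simp add: mod_simps)
    finally show ?thesis
      by (simp only: mod)
  qed
  have "bij_betw (\<lambda>t. (t + s) mod L) {t \<in> {0..<L}. P (t + s)} {t \<in> {0..<L}. P t}"
    by (rule bij_betw_byWitness[where f' = "\<lambda>t. (t - s) mod L"])
      (use assms(1) in \<open>auto simp: mod unshift mod_simps\<close>)
  thus ?thesis
    by (rule bij_betw_same_card)
qed

text \<open>Each remainder \<open>y\<close> modulo \<open>q\<close> admits exactly one quotient in
  \<open>{0..<p}\<close>, namely \<open>(g * y) mod p\<close>, so \<open>t mod q\<close> identifies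
  the active slots of a period with \<open>{0..<q}\<close>.\<close>

lemma card_slope_seq:
  assumes "p > 0" "q > 0"
  shows "card {t \<in> {0..<p * q}. slope_seq p q g t} = nat q"
proof -
  have range: "y + q * k \<in> {0..<p * q}" if "y \<in> {0..<q}" "k \<in> {0..<p}" for y k
  proof -
    have "q * k \<le> q * (p - 1)"
      using that assms by (intro mult_left_mono) auto
    thus ?thesis
      using that assms by (auto simp: algebra_simps)
  qed
  have div_range: "t div q \<in> {0..<p}" if "t \<in> {0..<p * q}" for t
    using that assms by (auto simp: pos_imp_zdiv_nonneg_iff zdiv_less)
  have "bij_betw (\<lambda>t. t mod q) {t \<in> {0..<p * q}. slope_seq p q g t} {0..<q}"
  proof (rule bij_betw_byWitness[where f' = "\<lambda>y. y + q * ((g * y) mod p)"])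
    show "\<forall>t\<in>{t \<in> {0..<p * q}. slope_seq p q g t}. t mod q + q * ((g * (t mod q)) mod p) = t"
    proof safe
      fix t assume t: "t \<in> {0..<p * q}" "slope_seq p q g t"
      have "(g * (t mod q)) mod p = t div q mod p"
        using t(2) by (simp add: slope_seq_def cong_def)
      also have "\<dots> = t div q"
        using div_range[OF t(1)] by simp
      finally show "t mod q + q * ((g * (t mod q)) mod p) = t"
        by simp
    qed
    show "(\<lambda>y. y + q * ((g * y) mod p)) ` {0..<q} \<subseteq> {t \<in> {0..<p * q}. slope_seq p q g t}"
      using range assms by (auto simp: slope_seq_def cong_def)
  qed (use assms in auto)
  thus ?thesis
    by (auto dest: bij_betw_same_card)
qed

section \<open>Linear congruences and pairwise collisions\<close>

lemma linear_cong_inj_on_div: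
  fixes d :: int
  assumes "coprime d p" "p > 0"
  shows "inj_on (\<lambda>y. y div p) {y. [d * y = c] (mod p)}"
proof (rule inj_onI)
  fix x y assume xy: "x \<in> {y. [d * y = c] (mod p)}" "y \<in> {y. [d * y = c] (mod p)}"
    and div: "x div p = y div p"
  have "[d * x = d * y] (mod p)"
    using xy by (auto intro: cong_trans cong_sym)
  hence "x mod p = y mod p"
    using assms(1) by (simp add: cong_mult_lcancel cong_def[symmetric])
  thus "x = y"
    using div by (metis div_mult_mod_eq)
qed

text \<open>As \<open>d\<close> is invertible modulo \<open>p\<close>, the solutions lie in one
  residue class. Each of the blocks of \<open>p\<close> consecutive integers numbered
  \<open>u\<close> to \<open>v\<close> then contains at most one of them.\<close>

lemma card_linear_cong_le:
  fixes d :: int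
  assumes "coprime d p" "p > 0" and A: "\<And>y. y \<in> A \<Longrightarrow> [d * y = c] (mod p) \<and> y div p \<in> {u..v}"
  shows "card A \<le> nat (v + 1 - u)"
proof -
  have "inj_on (\<lambda>y. y div p) A"
    using linear_cong_inj_on_div[OF assms(1,2), of c] by (rule inj_on_subset) (use A in auto)
  moreover have "(\<lambda>y. y div p) ` A \<subseteq> {u..v}"
    using A by auto
  ultimately have "card A \<le> card {u..v}"
    by (intro card_inj_on_le) auto
  thus ?thesis
    by simp
qed

text \<open>The interval consists of \<open>m\<close> blocks of length \<open>p\<close>, each with
  at most one solution per congruence. Only the block containing the threshold \<open>b\<close> can
  meet both congruences; counting it twice gives \<open>m + 1\<close>.\<close>

lemma card_piecewise_linear_cong_le:
  fixes d p m b c1 c2 :: int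
  assumes "coprime d p" "p > 0" "0 \<le> b" "b \<le> p * m"
  shows "card {y \<in> {0..<p * m}. [d * y = (if y < b then c1 else c2)] (mod p)} \<le> nat (m + 1)"
proof -
  let ?A = "{y \<in> {0..<b}. [d * y = c1] (mod p)}"
  let ?B = "{y \<in> {b..<p * m}. [d * y = c2] (mod p)}"
  have bm: "0 \<le> b div p" "b div p \<le> m"
    using assms(2-4) zdiv_mono1[of b "p * m" p] by (auto simp: pos_imp_zdiv_nonneg_iff)
  have "card ?A \<le> nat (b div p + 1 - 0)"
    by (rule card_linear_cong_le[OF assms(1,2), where c = c1])
      (use assms(2) in \<open>auto simp: pos_imp_zdiv_nonneg_iff intro!: zdiv_mono1\<close>)
  moreover have "y div p < m" if "y < p * m" for y
    using that assms(2) by (simp add: zdiv_less mult.commute)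
  hence "card ?B \<le> nat ((m - 1) + 1 - b div p)"
    by (intro card_linear_cong_le[OF assms(1,2), where c = c2])
      (use assms(2) in \<open>auto intro!: zdiv_mono1\<close>)
  moreover have "{y \<in> {0..<p * m}. [d * y = (if y < b then c1 else c2)] (mod p)} \<subseteq> ?A \<union> ?B"
    by auto
  hence "card {y \<in> {0..<p * m}. [d * y = (if y < b then c1 else c2)] (mod p)} \<le> card (?A \<union> ?B)"
    by (intro card_mono finite_UnI finite_subset[of ?A "{0..<b}"] finite_subset[of ?B "{b..<p * m}"])
      auto
  moreover have "card (?A \<union> ?B) \<le> card ?A + card ?B"
    by (rule card_Un_le)
  ultimately show ?thesis
    using bm by linarith
qed

lemma slope_seq_crosscorrelation_le:
  assumes "coprime (g - h) p" "p > 0" "m > 0" and q: "q = p * m"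
  shows "card {t \<in> {0..<p * q}. slope_seq p q g t \<and> slope_seq p q h (t + s)} \<le> nat (m + 1)"
proof -
  have q0: "q > 0"
    using assms by simp
  define b c where "b = s mod q" and "c = s div q"
  have b: "0 \<le> b" "b < q"
    using q0 by (auto simp: b_def)
  \<comment> \<open>Right-hand sides left after eliminating the quotient of \<open>t\<close>:
    \<open>c1\<close> if adding \<open>b\<close> to the remainder gives no carry, \<open>c2\<close>
    if it does.\<close>
  define c1 c2 where "c1 = h * b - c" and "c2 = h * (b - q) - (c + 1)"
  let ?T = "{t \<in> {0..<p * q}. slope_seq p q g t \<and> slope_seq p q h (t + s)}"
  let ?Y = "{y \<in> {0..<p * m}. [(g - h) * y = (if y < q - b then c1 else c2)] (mod p)}"
  \<comment> \<open>A collision slot is determined by its remainder: slope \<open>g\<close> fixes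
    the quotient modulo \<open>p\<close>, and within a period the quotient lies in
    \<open>{0..<p}\<close>.\<close>
  have "inj_on (\<lambda>t. t mod q) ?T"
  proof (rule inj_onI)
    fix t t' assume t: "t \<in> ?T" "t' \<in> ?T" and eq: "t mod q = t' mod q"
    have "[t div q = t' div q] (mod p)"
      using t eq by (auto simp: slope_seq_def intro: cong_trans cong_sym)
    moreover have "t div q \<in> {0..<p}" "t' div q \<in> {0..<p}"
      using t q0 by (auto simp: pos_imp_zdiv_nonneg_iff zdiv_less)
    ultimately have "t div q = t' div q"
      by (simp add: cong_def)
    thus "t = t'"
      using eq by (metis div_mult_mod_eq)
  qed
  moreover have "(\<lambda>t. t mod q) ` ?T \<subseteq> ?Y"
  proof (rule image_subsetI)
    fix t assume t: "t \<in> ?T"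
    define y k where "y = t mod q" and "k = t div q"
    have y: "0 \<le> y" "y < q"
      using q0 by (auto simp: y_def)
    have g: "[k = g * y] (mod p)"
      using t by (simp add: slope_seq_def y_def k_def)
    have ts: "t + s = (y + b) + q * (k + c)"
      by (simp add: y_def k_def b_def c_def algebra_simps)
    have "[(g - h) * y = (if y < q - b then c1 else c2)] (mod p)"
    proof (cases "y < q - b")
      case True
      have "(t + s) mod q = y + b" "(t + s) div q = k + c"
        unfolding ts using True y b by auto
      hence h: "[k + c = h * (y + b)] (mod p)"
        using t by (simp add: slope_seq_def)
      \<comment> \<open>\<open>h\<close> minus \<open>g\<close>, padded on both sides so that the
        left side collapses to \<open>(g - h) * y\<close> and the right side to
        \<open>c1\<close>.\<close>
      have "[k + c - k - c + g * y - h * y = h * (y + b) - g * y - c + g * y - h * y] (mod p)"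
        by (intro cong_add cong_diff cong_refl g h)
      thus ?thesis
        using True by (simp add: c1_def algebra_simps)
    next
      case False
      \<comment> \<open>Carry: the remainder drops by \<open>q\<close> and the quotient gains
        1.\<close>
      have ts': "t + s = (y + b - q) + q * (k + c + 1)"
        unfolding ts by (simp add: algebra_simps)
      have "(t + s) mod q = y + b - q" "(t + s) div q = k + c + 1"
        unfolding ts' mod_mult_self2 div_mult_self2[OF q0[THEN less_imp_neq, symmetric]]
        using False y b by (simp_all only: mod_pos_pos_trivial div_pos_pos_trivial)
      hence h: "[k + c + 1 = h * (y + b - q)] (mod p)"
        using t by (simp add: slope_seq_def)
      have "[k + c + 1 - k - (c + 1) + g * y - h * y =
          h * (y + b - q) - g * y - (c + 1) + g * y - h * y] (mod p)"
        by (intro cong_add cong_diff cong_refl g h)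
      thus ?thesis
        using False by (simp add: c2_def algebra_simps)
    qed
    thus "t mod q \<in> ?Y"
      using y q by (simp add: y_def)
  qed
  moreover have "finite ?Y"
    by (rule finite_subset[of _ "{0..<p * m}"]) auto
  ultimately have "card ?T \<le> card ?Y"
    by (rule card_inj_on_le)
  also have "\<dots> \<le> nat (m + 1)"
    by (rule card_piecewise_linear_cong_le) (use assms b in auto)
  finally show ?thesis .
qed

section \<open>Union bound for points covered exactly once\<close>

lemma card_unique_cover_ge:
  fixes W :: "nat \<Rightarrow> 'a set"
  assumes fin: "finite T" "\<And>i. i < M \<Longrightarrow> W i \<subseteq> T"
    and weight: "\<And>i. i < M \<Longrightarrow> card (W i) = w"
    and corr: "\<And>i j. i < M \<Longrightarrow> j < M \<Longrightarrow> i \<noteq> j \<Longrightarrow> card (W i \<inter> W j) \<le> r"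
  shows "real M * (real w - (real M - 1) * real r) \<le> real (card {t \<in> T. \<exists>!i. i < M \<and> t \<in> W i})"
proof -
  \<comment> \<open>The points of \<open>W i\<close> that lie in no other set. At most
    \<open>(M - 1) * r\<close> of the \<open>w\<close> points are removed, and the remainders for
    different \<open>i\<close> are disjoint, so their sizes add up.\<close>
  define U where "U = (\<lambda>i. W i - (\<Union>j\<in>{..<M} - {i}. W i \<inter> W j))"
  have finW: "finite (W i)" if "i < M" for i
    using fin that finite_subset by blast
  have U_ge: "real w - (real M - 1) * real r \<le> real (card (U i))" if i: "i < M" for i
  proof -
    let ?B = "\<Union>j\<in>{..<M} - {i}. W i \<inter> W j"
    have "card ?B \<le> (\<Sum>j\<in>{..<M} - {i}. card (W i \<inter> W j))"
      by (rule card_UN_le) simp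
    also have "\<dots> \<le> (\<Sum>j\<in>{..<M} - {i}. r)"
      using corr i by (intro sum_mono) auto
    also have "\<dots> = (M - 1) * r"
      using i by simp
    finally have B: "real (card ?B) \<le> real ((M - 1) * r)"
      by (rule of_nat_mono)
    have "?B \<subseteq> W i"
      by auto
    hence "card (U i) = card (W i) - card ?B" "card ?B \<le> card (W i)"
      unfolding U_def using finW[OF i]
      by (auto intro!: card_Diff_subset card_mono intro: finite_subset)
    thus ?thesis
      using B i weight[OF i] by (simp add: of_nat_diff)
  qed
  have disj: "U i \<inter> U j = {}" if "i < M" "j < M" "i \<noteq> j" for i j
    using that by (auto simp: U_def)
  have "real M * (real w - (real M - 1) * real r) \<le> (\<Sum>i<M. real (card (U i)))"
    using sum_mono[of "{..<M}" "\<lambda>_. real w - (real M - 1) * real r" "\<lambda>i. real (card (U i))"] U_ge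
    by simp
  also have "\<dots> = real (card (\<Union>i<M. U i))"
    using finW disj by (subst card_UN_disjoint) (auto simp: U_def)
  also have "(\<Union>i<M. U i) \<subseteq> {t \<in> T. \<exists>!i. i < M \<and> t \<in> W i}"
  proof
    fix t assume "t \<in> (\<Union>i<M. U i)"
    then obtain i where i: "i < M" "t \<in> U i"
      by auto
    hence "t \<in> W i" "\<And>j. j < M \<Longrightarrow> t \<in> W j \<Longrightarrow> j = i"
      by (auto simp: U_def)
    thus "t \<in> {t \<in> T. \<exists>!i. i < M \<and> t \<in> W i}"
      using i(1) fin(2)[OF i(1)] by blast
  qed
  hence "real (card (\<Union>i<M. U i)) \<le> real (card {t \<in> T. \<exists>!i. i < M \<and> t \<in> W i})"
    using fin(1) by (intro of_nat_mono card_mono) auto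
  finally show ?thesis .
qed

section \<open>The family with p = 2 M + 1 and its throughput\<close>

definition slope_family :: "nat \<Rightarrow> nat \<Rightarrow> (int \<Rightarrow> bool) list" where
  "slope_family m M =
     map (\<lambda>g. slope_seq (int (2 * M + 1)) (int (2 * M + 1) * int m) (int g)) [0..<M]"

definition slope_period :: "nat \<Rightarrow> nat \<Rightarrow> nat" where
  "slope_period m M = (2 * M + 1) * ((2 * M + 1) * m)"

lemma length_slope_family [simp]: "length (slope_family m M) = M"
  by (simp add: slope_family_def)

lemma protocol_sequence_set_slope_family:
  assumes "prime (2 * M + 1)" "m > 0"
  shows "protocol_sequence_set (slope_period m M) (slope_family m M)"
proof -
  have M: "M > 0"
    using assms(1) by (cases M) auto
  define p q where "p = int (2 * M + 1)" and "q = p * int m"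
  have p: "prime p" "p > 1"
    using assms(1) M unfolding p_def by (simp only: prime_nat_int_transfer, simp)
  have "p * 1 \<le> p * int m"
    using assms(2) p by (intro mult_left_mono) auto
  hence q: "q > 1"
    using p(2) unfolding q_def by linarith
  have fam: "slope_family m M = map (\<lambda>g. slope_seq p q (int g)) [0..<M]"
    by (simp add: slope_family_def p_def q_def)
  have period: "int (slope_period m M) = p * q"
    by (simp add: slope_period_def p_def q_def algebra_simps)
  have "inj_on (\<lambda>g. slope_seq p q (int g)) {0..<M}"
  proof (rule inj_onI)
    fix g h assume gh: "g \<in> {0..<M}" "h \<in> {0..<M}"
      and "slope_seq p q (int g) = slope_seq p q (int h)"
    hence "[int g = int h] (mod p)"
      using slope_seq_eq_imp_cong[OF q] by blast
    \<comment> \<open>Both slopes are below \<open>M\<close>, hence below \<open>p\<close>, so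
      congruence is equality.\<close>
    thus "g = h"
      using gh by (simp add: cong_def p_def)
  qed
  moreover have "slope_period m M > 0"
    using assms(2) by (simp add: slope_period_def)
  ultimately show ?thesis
    unfolding protocol_sequence_set_def fam period
    using slope_seq_periodic[of q p] q by (auto simp: distinct_map)
qed

text \<open>For \<open>M\<close> users the union bound is roughly \<open>m * M * (p - M)\<close>. It
  is largest for \<open>M\<close> near \<open>p / 2\<close>, which explains the choice
  \<open>p = 2 * M + 1\<close>, and there it is about a quarter of the period
  \<open>p * p * m\<close>. The extra collision in \<open>m + 1\<close> costs the term
  \<open>1 / real m\<close>.\<close>

lemma throughput_slope_family_ge:
  assumes "prime (2 * M + 1)" "m > 0"
  shows "throughput (slope_period m M) (slope_family m M) \<tau> \<ge>
    (1 - 1 / real (2 * M + 1) - 1 / real m) / 4"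
proof -
  have M: "M > 0"
    using assms(1) by (cases M) auto
  define p q where "p = int (2 * M + 1)" and "q = p * int m"
  have p: "prime p" "p > 0"
    using assms(1) unfolding p_def by (simp only: prime_nat_int_transfer, simp)
  have q: "q > 0"
    using p assms(2) by (simp add: q_def)
  have period: "int (slope_period m M) = p * q"
    by (simp add: slope_period_def p_def q_def algebra_simps)
  define T where "T = {0..<p * q}"
  define W where "W = (\<lambda>i. {t \<in> T. slope_seq p q (int i) (t + \<tau> i)})"
  have pq: "p * q > 0"
    using p q by simp
  have weight: "card (W i) = nat q" for i
    using card_periodic_shift[of "p * q" "slope_seq p q (int i)" "\<tau> i"]
      card_slope_seq[of p q "int i"] slope_seq_periodic[OF q] p(2) q pq
    by (simp add: W_def T_def)
  have corr: "card (W i \<inter> W j) \<le> m + 1" if ij: "i < M" "j < M" "i \<noteq> j" for i j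
  proof -
    \<comment> \<open>The delay of user \<open>i\<close> is shifted away, so that the
      crosscorrelation bound applies with the relative delay
      \<open>\<tau> j - \<tau> i\<close>.\<close>
    define P where "P = (\<lambda>t. slope_seq p q (int i) t \<and> slope_seq p q (int j) (t + (\<tau> j - \<tau> i)))"
    have "slope_seq p q (int j) (t + p * q + (\<tau> j - \<tau> i)) =
        slope_seq p q (int j) (t + (\<tau> j - \<tau> i))" for t
      using slope_seq_periodic[OF q, of p "int j" "t + (\<tau> j - \<tau> i)"] by (simp add: algebra_simps)
    hence per: "P (t + p * q) = P t" for t
      using slope_seq_periodic[OF q] by (simp add: P_def)
    have "W i \<inter> W j = {t \<in> {0..<p * q}. P (t + \<tau> i)}"
      by (auto simp: W_def T_def P_def)
    hence "card (W i \<inter> W j) = card {t \<in> {0..<p * q}. P t}"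
      using card_periodic_shift[of "p * q" P "\<tau> i", OF pq per] by simp
    \<comment> \<open>Distinct indices differ by less than \<open>M < p\<close>; primality of
      \<open>p\<close> then makes the difference invertible.\<close>
    moreover have "\<not> p dvd int i - int j"
      using ij zdvd_imp_le[of p "\<bar>int i - int j\<bar>"] by (auto simp: p_def)
    hence "coprime (int i - int j) p"
      using p(1) by (simp add: prime_imp_coprime coprime_commute)
    hence "card {t \<in> {0..<p * q}. P t} \<le> nat (int m + 1)"
      unfolding P_def by (rule slope_seq_crosscorrelation_le) (use p assms in \<open>auto simp: q_def\<close>)
    ultimately show ?thesis
      by simp
  qed
  have "real M * (real (nat q) - (real M - 1) * real (m + 1)) \<le>
      real (card {t \<in> T. \<exists>!i. i < M \<and> t \<in> W i})"
    by (rule card_unique_cover_ge) (use weight corr in \<open>auto simp: T_def W_def\<close>)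
  also have "{t \<in> T. \<exists>!i. i < M \<and> t \<in> W i} =
      {t \<in> {0..<int (slope_period m M)}. \<exists>!i. transmits (slope_family m M) \<tau> i t}"
  proof -
    have "i < M \<and> t \<in> W i \<longleftrightarrow> transmits (slope_family m M) \<tau> i t" if "t \<in> T" for i t
      using that by (auto simp: transmits_def W_def slope_family_def p_def q_def)
    thus ?thesis
      unfolding period T_def[symmetric] by (intro Collect_cong conj_cong) simp_all
  qed
  finally have card: "real M * (real (nat q) - (real M - 1) * real (m + 1)) \<le>
      throughput (slope_period m M) (slope_family m M) \<tau> * real (slope_period m M)"
    using period pq by (auto simp: throughput_def)
  define P where "P = real (2 * M + 1)"
  have P: "P > 0" "real M = (P - 1) / 2" "real (nat q) = P * real m"
    "real (slope_period m M) = P * P * real m"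
    by (auto simp: P_def q_def p_def slope_period_def nat_mult_distrib algebra_simps)
  have m: "real m > 0"
    using assms(2) by simp
  have "(1 - 1 / P - 1 / real m) / 4 * (P * P * real m) = ((P * P - P) * real m - P * P) / 4"
    using P m by (simp add: field_simps)
  also have "\<dots> \<le> (P - 1) / 2 * (P * real m - ((P - 1) / 2 - 1) * (real m + 1))"
  proof -
    \<comment> \<open>The difference of the two sides is computed exactly; it is nonnegative because
      \<open>P \<ge> 1\<close>.\<close>
    have "(P - 1) / 2 * (P * real m - ((P - 1) / 2 - 1) * (real m + 1)) -
      ((P * P - P) * real m - P * P) / 4 = (4 * P - 3 + 3 * (P - 1) * real m) / 4"
      by (simp add: field_simps)
    moreover have "P \<ge> 1"
      by (simp add: P_def)
    hence "0 \<le> (4 * P - 3 + 3 * (P - 1) * real m) / 4"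
      by simp
    ultimately show ?thesis
      by linarith
  qed
  also have "\<dots> \<le> throughput (slope_period m M) (slope_family m M) \<tau> * (P * P * real m)"
    using card by (simp add: P add.commute)
  finally show ?thesis
    unfolding P_def[symmetric] using P(1) m by simp
qed

section \<open>Choice of parameters and asymptotics\<close>

theorem theorem8:
  fixes \<epsilon> \<delta> :: real
  assumes "\<epsilon> > 0" and "\<delta> > 0"
  shows "\<exists>\<C> :: (nat \<times> (int \<Rightarrow> bool) list) set.
    infinite \<C> \<and>
    (\<forall>(L, A)\<in>\<C>. protocol_sequence_set L A) \<and>
    (\<forall>N. \<exists>(L, A)\<in>\<C>. length A \<ge> N) \<and>
    (\<exists>K. \<forall>(L, A)\<in>\<C>. real L \<le> K * real (length A) powr (2 + \<epsilon>)) \<and>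
    (\<exists>M\<^sub>0. \<forall>M\<ge>M\<^sub>0. \<forall>(L, A)\<in>\<C>. length A = M \<longrightarrow>
      (\<forall>\<tau> :: nat \<Rightarrow> int. throughput L A \<tau> \<ge> 0.25 - \<delta>))"
proof -
  \<comment> \<open>\<open>m\<close> depends on \<delta> alone, so it enters the length only as a
    constant factor, while \<open>1 / real m \<le> \<delta>\<close> controls the throughput
    loss.\<close>
  define m where "m = nat \<lceil>1 / \<delta>\<rceil>"
  have m: "m > 0" "1 / real m \<le> \<delta>"
  proof -
    have "1 / \<delta> \<le> real m"
      unfolding m_def by (rule real_nat_ceiling_ge)
    moreover have "1 / \<delta> > 0"
      using assms by simp
    ultimately have "real m > 0" "1 \<le> real m * \<delta>"
      using assms by (linarith, simp add: field_simps)
    thus "m > 0" "1 / real m \<le> \<delta>"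
      by (auto simp: field_simps)
  qed
  \<comment> \<open>One member for each \<open>M\<close> with \<open>2 * M + 1\<close> prime; such
    \<open>M\<close> are unbounded because there are infinitely many primes, all odd beyond
    2.\<close>
  define \<C> where "\<C> = (\<lambda>M. (slope_period m M, slope_family m M)) ` {M. prime (2 * M + 1)}"
  have unbounded: "\<exists>(L, A)\<in>\<C>. length A \<ge> N" for N
  proof -
    obtain p :: nat where p: "prime p" "p > 2 * N + 2"
      using bigger_prime by blast
    hence "odd p"
      using prime_odd_nat by simp
    then obtain M where "p = 2 * M + 1"
      by (elim oddE)
    thus ?thesis
      using p by (auto simp: \<C>_def)
  qed
  have "infinite \<C>"
  proof
    assume "finite \<C>"
    then obtain N where "\<forall>n\<in>(length \<circ> snd) ` \<C>. n \<le> N"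
      using finite_nat_set_iff_bounded_le by blast
    thus False
      using unbounded[of "Suc N"] by fastforce
  qed
  moreover have "\<forall>(L, A)\<in>\<C>. protocol_sequence_set L A"
    using protocol_sequence_set_slope_family m by (auto simp: \<C>_def)
  \<comment> \<open>The length is quadratic in \<open>M\<close>: the factor 9 comes from
    \<open>2 * M + 1 \<le> 3 * M\<close>, and \<epsilon> only enlarges the bound since
    \<open>M \<ge> 1\<close>.\<close>
  moreover have "real (slope_period m M) \<le> (9 * real m) * real M powr (2 + \<epsilon>)"
    if "prime (2 * M + 1)" for M
  proof -
    have M: "real M \<ge> 1"
      using that by (cases M) auto
    have "real (slope_period m M) = (2 * real M + 1)\<^sup>2 * real m"
      by (simp add: slope_period_def power2_eq_square algebra_simps)
    also have "\<dots> \<le> (3 * real M)\<^sup>2 * real m"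
      using M by (intro mult_right_mono power_mono) auto
    also have "\<dots> = 9 * real m * real M powr 2"
      using M by (simp add: power2_eq_square)
    also have "\<dots> \<le> 9 * real m * real M powr (2 + \<epsilon>)"
      using M assms by (intro mult_left_mono powr_mono) auto
    finally show ?thesis .
  qed
  hence "\<exists>K. \<forall>(L, A)\<in>\<C>. real L \<le> K * real (length A) powr (2 + \<epsilon>)"
    by (intro exI[of _ "9 * real m"]) (auto simp: \<C>_def)
  \<comment> \<open>From \<open>M \<ge> m\<close> on, both error terms are at most \<delta>, so a
    quarter of their sum is at most half of \<delta>.\<close>
  moreover have "throughput (slope_period m M) (slope_family m M) \<tau> \<ge> 0.25 - \<delta>"
    if "prime (2 * M + 1)" "M \<ge> m" for M \<tau>
  proof -
    have "1 / real (2 * M + 1) \<le> 1 / real m"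
      using that(2) m(1) by (intro divide_left_mono) auto
    moreover have "0.25 - \<delta> \<le> (1 - u - v) / 4" if "u \<le> v" "v \<le> \<delta>" for u v
      using that assms(2) by simp
    ultimately have "0.25 - \<delta> \<le> (1 - 1 / real (2 * M + 1) - 1 / real m) / 4"
      using m(2) by blast
    thus ?thesis
      using throughput_slope_family_ge[OF that(1) m(1), of \<tau>] by (rule order_trans)
  qed
  hence "\<exists>M\<^sub>0. \<forall>M\<ge>M\<^sub>0. \<forall>(L, A)\<in>\<C>. length A = M \<longrightarrow>
      (\<forall>\<tau> :: nat \<Rightarrow> int. throughput L A \<tau> \<ge> 0.25 - \<delta>)"
    by (intro exI[of _ m]) (auto simp: \<C>_def)
  ultimately show ?thesis
    using unbounded by (intro exI[of _ \<C>]) blast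
qed

end
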